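(* Let $(\gamma_n)_{n\ge 0}$ be the simple random walk on $\Gamma\cong\mathbb{Z}[\frac12]$ started at $\gamma_0=0$, i.e. the Markov chain on $\mathbb{Z}[\frac12]$ which from a point $\gamma$ moves to each of $\widetilde A(\gamma)$, $\widetilde A^{-1}(\gamma)$, $\widetilde B(\gamma)$, $\widetilde B^{-1}(\gamma)$ with probability $\frac14$ (coinciding targets have their probabilities added). Then almost surely $$|\gamma_n|_2\longrightarrow\infty\qquad\text{as } n\to\infty .$$
   Context: $\widetilde A,\widetilde B:\mathbb{R}\to\mathbb{R}$ are the piecewise linear homeomorphisms $\widetilde A(\gamma)=\gamma-1$ and $\widetilde B(\gamma)=\gamma$ for $\gamma\le 0$, $\widetilde B(\gamma)=\gamma/2$ for $0\le\gamma\le 2$, $\widetilde B(\gamma)=\gamma-1$ for $\gamma\ge 2$. They generate a group $\widetilde F$ isomorphic to Thompson's group $F$, and both they and their inverses preserve the set $\mathbb{Z}[\frac12]$ of dyadic rational numbers. $\Gamma$ denotes the Schreier graph of the action of $\widetilde F$ on $\mathbb{Z}[\frac12]$ with respect to the generating set $K=\{\widetilde A,\widetilde B,\widetilde A^{-1},\widetilde B^{-1}\}$: its vertex set is $\mathbb{Z}[\frac12]$, and each $\gamma$ is joined to $g(\gamma)$, $g\in K$. $|\cdot|_2$ is the 2-adic norm: $|\gamma|_2=2^{-n}$ if $\gamma=(2m+1)2^n$ with $m,n\in\mathbb{Z}$, and $|0|_2=0$. *)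

theory Defs
  imports "HOL-Probability.Probability"
begin

definition tA :: "real \<Rightarrow> real" where
  "tA x = x - 1"

definition tB :: "real \<Rightarrow> real" where
  "tB x = (if x \<le> 0 then x else if x \<le> 2 then x / 2 else x - 1)"

text \<open>The set \<open>dyadics\<close> of HOL-Analysis contains only the nonnegative dyadic rationals.\<close>

definition dyadic_rats :: "real set" where
  "dyadic_rats = {x. \<exists>(m::int) (k::nat). x = of_int m / 2 ^ k}"

text \<open>The value is only meaningful on \<^const>\<open>dyadic_rats\<close>; see \<open>norm2_odd_times_power\<close> below.\<close>

definition norm2 :: "real \<Rightarrow> real" where
  "norm2 x = (if x = 0 then 0
     else 2 powi (- (THE n::int. \<exists>m::int. x = of_int (2 * m + 1) * 2 powi n)))"

definition gens :: "(real \<Rightarrow> real) set" where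
  "gens = {tA, tB, inv tA, inv tB}"

text \<open>
  Simple random walk on the Schreier graph of an action with respect to a finite generating
  set \<open>K\<close>: each generator is an edge leaving \<open>x\<close>, so loops and multiple edges are counted
  with multiplicity.
\<close>

definition schreier_step :: "('s \<Rightarrow> 's) set \<Rightarrow> 's \<Rightarrow> 's pmf" where
  "schreier_step K x = map_pmf (\<lambda>g. g x) (pmf_of_set K)"

text \<open>
  The last clause is the Markov property
  \<open>P(X\<^sub>n\<^sub>+\<^sub>1 = y | X\<^sub>0 = x\<^sub>0, \<dots>, X\<^sub>n = x\<^sub>n) = P x\<^sub>n y\<close>, multiplied out so that
  conditioning on null events imposes nothing.
\<close>

definition markov_chain ::
  "'w measure \<Rightarrow> 's set \<Rightarrow> ('s \<Rightarrow> 's pmf) \<Rightarrow> 's \<Rightarrow> (nat \<Rightarrow> 'w \<Rightarrow> 's) \<Rightarrow> bool" where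
  "markov_chain M S P x0 X \<longleftrightarrow>
     prob_space M \<and>
     (\<forall>n. X n \<in> measurable M (count_space S)) \<and>
     (AE w in M. X 0 w = x0) \<and>
     (\<forall>n x. \<forall>y\<in>S. (\<forall>i\<le>n. x i \<in> S) \<longrightarrow>
        measure M {w \<in> space M. (\<forall>i\<le>n. X i w = x i) \<and> X (Suc n) w = y}
        = measure M {w \<in> space M. \<forall>i\<le>n. X i w = x i} * pmf (P (x n)) y)"

lemma inv_tA: "inv tA = (\<lambda>x. x + 1)"
  by (rule inv_equality) (auto simp: tA_def)

lemma inv_tB: "inv tB = (\<lambda>x. if x \<le> 0 then x else if x \<le> 1 then 2 * x else x + 1)"
  by (rule inv_equality) (auto simp: tB_def)

lemma bij_tA: "bij tA"
  by (rule bij_betw_byWitness[where f' = "\<lambda>x. x + 1"]) (auto simp: tA_def)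

lemma bij_tB: "bij tB"
  by (rule bij_betw_byWitness[where f' = "\<lambda>x. if x \<le> 0 then x else if x \<le> 1 then 2 * x else x + 1"])
    (auto simp: tB_def)

lemma dyadic_rats_add_int: "x \<in> dyadic_rats \<Longrightarrow> x + of_int j \<in> dyadic_rats"
proof -
  assume "x \<in> dyadic_rats"
  then obtain m :: int and k :: nat where x: "x = of_int m / 2 ^ k"
    by (auto simp: dyadic_rats_def)
  have "x + of_int j = of_int (m + j * 2 ^ k) / 2 ^ k"
    by (simp add: x field_simps)
  then show ?thesis unfolding dyadic_rats_def by blast
qed

lemma gens_dyadic_rats:
  assumes "g \<in> gens" "x \<in> dyadic_rats"
  shows "g x \<in> dyadic_rats"
proof -
  obtain m :: int and k :: nat where x: "x = of_int m / 2 ^ k"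
    using assms(2) by (auto simp: dyadic_rats_def)
  have "x / 2 = of_int m / 2 ^ Suc k" "2 * x = of_int (2 * m) / 2 ^ k"
    by (simp_all add: x)
  then have "x / 2 \<in> dyadic_rats" "2 * x \<in> dyadic_rats"
    unfolding dyadic_rats_def by blast+
  then show ?thesis
    using assms dyadic_rats_add_int[OF assms(2), of 1] dyadic_rats_add_int[OF assms(2), of "-1"]
    by (auto simp: gens_def inv_tA inv_tB) (auto simp: tA_def tB_def)
qed

lemma gens_distinct: "distinct [tA, tB, inv tA, inv tB]"
proof -
  have "tA 1 = 0" "tB 1 = 1/2" "inv tA 1 = 2" "inv tB 1 = 2"
    "inv tA 0 = 1" "inv tB 0 = 0"
    by (simp_all add: inv_tA inv_tB tA_def tB_def)
  then show ?thesis
    by (auto dest: fun_cong[where x = 1] fun_cong[where x = 0])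
qed

lemma card_gens: "card gens = 4"
  using distinct_card[OF gens_distinct] by (simp add: gens_def)

lemma pmf_schreier_step:
  "pmf (schreier_step gens x) y =
     (of_bool (tA x = y) + of_bool (inv tA x = y) + of_bool (tB x = y) + of_bool (inv tB x = y)) / 4"
proof -
  have fin: "finite gens" "gens \<noteq> {}"
    by (auto simp: gens_def)
  have "pmf (schreier_step gens x) y = measure (pmf_of_set gens) {g. g x = y}"
    by (simp add: schreier_step_def pmf_map vimage_def)
  also have "\<dots> = real (card (gens \<inter> {g. g x = y})) / 4"
    using fin by (simp add: measure_pmf_of_set card_gens)
  also have "real (card (gens \<inter> {g. g x = y})) = (\<Sum>g\<in>gens. of_bool (g x = y))"
    using fin by simp
  also have "\<dots> = of_bool (tA x = y) + of_bool (inv tA x = y) + of_bool (tB x = y) + of_bool (inv tB x = y)"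
    using gens_distinct unfolding gens_def by (subst sum.insert; simp)+
  finally show ?thesis .
qed

lemma odd_times_power_unique:
  fixes m m' n n' :: int
  assumes "of_int (2 * m + 1) * 2 powi n = (of_int (2 * m' + 1) * 2 powi n' :: real)"
  shows "n = n'"
proof -
  have aux: False
    if eq: "of_int (2 * a + 1) * 2 powi p = (of_int (2 * b + 1) * 2 powi q :: real)"
      and "p < q" for a b p q :: int
  proof -
    define d where "d = nat (q - p - 1)"
    have q: "q = p + int (Suc d)" using \<open>p < q\<close> by (simp add: d_def)
    have "2 powi q = (2 powi p * 2 ^ Suc d :: real)"
      unfolding q by (subst power_int_add) (simp_all del: of_nat_Suc power_Suc)
    with eq have "(of_int (2 * a + 1) :: real) = of_int ((2 * b + 1) * 2 ^ Suc d)"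
      by simp
    then have "2 * a + 1 = (2 * b + 1) * 2 ^ Suc d"
      by (simp only: of_int_eq_iff)
    then have "even (2 * a + 1)" by simp
    then show False by simp
  qed
  show ?thesis
    using aux[OF assms] aux[OF assms[symmetric]] by (meson linorder_neqE)
qed

lemma norm2_odd_times_power:
  "norm2 (of_int (2 * m + 1) * 2 powi n) = 2 powi (- n)"
proof -
  have "2 * m + 1 \<noteq> 0" by presburger
  then have nz: "of_int (2 * m + 1) * 2 powi n \<noteq> (0::real)"
    by (simp only: mult_eq_0_iff of_int_eq_0_iff power_int_eq_0_iff) simp
  have "(THE n'::int. \<exists>m'::int. of_int (2 * m + 1) * 2 powi n
      = (of_int (2 * m' + 1) * 2 powi n' :: real)) = n"
    by (rule the_equality) (use odd_times_power_unique in blast)+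
  with nz show ?thesis by (simp only: norm2_def if_False)
qed

end

theory Submission
  imports Defs
begin

text \<open>
  The cosets \<open>\<theta> + \<int>\<close>, \<open>0 \<le> \<theta> < 1\<close>, form a tree with root \<open>\<int>\<close> in which every coset but the root has two
  children: for \<open>\<theta> > 0\<close>, \<open>tB\<close> leads from \<open>\<theta>\<close> and from \<open>\<theta> + 1\<close> to the two children, while only its inverse
  at \<open>\<theta>\<close> leads to the parent. On the rest of a coset, which consists of two half-lines, the walk
  is symmetric. Hence the walk drifts away from the root. The drift is
  witnessed by a nonnegative, strictly superharmonic function \<open>f\<close> that decays geometrically in the depth
  in the tree and tends slowly to infinity along each half-line. Strictness makes the expected
  sum of the decrements of \<open>f\<close> finite, so that every finite set is visited finitely often, and the
  maximal inequality for supermartingales makes \<open>f\<close> almost surely bounded along the walk. Since only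
  finitely many points of bounded depth have a bounded value of \<open>f\<close>, the depth, which is
  \<open>log\<^sub>2\<close> of the norm outside \<open>\<int>\<close>, tends to infinity.
\<close>

subsection \<open>Superharmonic functions of Markov chains\<close>

text \<open>As \<open>S\<close> is countable, there are countably many histories up to time
  \<open>n\<close>, so every predicate \<open>Q\<close> of the history is measurable. Restricting to
  \<open>{..n}\<close> makes a history an extensional function, so that it is determined by its
  values.\<close>

lemma markov_chain_sets:
  assumes "markov_chain M S P x0 X" "countable S"
  shows "{w \<in> space M. Q (restrict (\<lambda>i. X i w) {..n})} \<in> sets M"
    and "\<And>g. (\<lambda>w. g (X n w) :: ennreal) \<in> borel_measurable M"
    and "\<And>w. w \<in> space M \<Longrightarrow> X n w \<in> S"
proof -
  have X: "X i \<in> measurable M (count_space S)" for i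
    using assms by (auto simp: markov_chain_def)
  show XS: "X n w \<in> S" if "w \<in> space M" for w n
    using measurable_space[OF X that, of n] by simp
  show "(\<lambda>w. g (X n w) :: ennreal) \<in> borel_measurable M" for g
    by (rule measurable_compose[OF X]) simp
  let ?I = "{h \<in> {..n} \<rightarrow>\<^sub>E S. Q h}"
  have ci: "countable ?I"
    by (rule countable_subset[of _ "{..n} \<rightarrow>\<^sub>E S"]) (use assms(2) in \<open>auto intro: countable_PiE\<close>)
  have at: "{w \<in> space M. \<forall>i\<le>n. X i w = h i} \<in> sets M" for h
  proof -
    have "X i -` {h i} \<inter> space M \<in> sets M" for i
    proof (cases "h i \<in> S")
      case True
      then show ?thesis by (intro measurable_sets[OF X]) simp
    next
      case False
      then have "X i w \<noteq> h i" if "w \<in> space M" for w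
        using XS[OF that, of i] by auto
      then have "X i -` {h i} \<inter> space M = {}" by auto
      then show ?thesis by simp
    qed
    then have "(\<Inter>i\<le>n. X i -` {h i} \<inter> space M) \<in> sets M"
      by (intro sets.finite_INT) auto
    also have "(\<Inter>i\<le>n. X i -` {h i} \<inter> space M) = {w \<in> space M. \<forall>i\<le>n. X i w = h i}"
      by auto
    finally show ?thesis .
  qed
  have "{w \<in> space M. Q (restrict (\<lambda>i. X i w) {..n})}
      = (\<Union>h\<in>?I. {w \<in> space M. \<forall>i\<le>n. X i w = h i})" (is "?L = ?R")
  proof (intro equalityI subsetI)
    fix w assume "w \<in> ?L"
    then show "w \<in> ?R" using XS
      by (intro UN_I[of "restrict (\<lambda>i. X i w) {..n}"]) auto
  next
    fix w assume "w \<in> ?R"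
    then obtain h where h: "h \<in> ?I" "w \<in> space M" "\<forall>i\<le>n. X i w = h i" by blast
    then have "restrict (\<lambda>i. X i w) {..n} = h"
      by (intro ext) (auto simp: PiE_def extensional_def restrict_def)
    then show "w \<in> ?L" using h by simp
  qed
  also have "\<dots> \<in> sets M" by (rule sets.countable_UN''[OF ci at])
  finally show "?L \<in> sets M" .
qed

text \<open>This is countable additivity of the measure with density \<open>f\<close>.\<close>

lemma nn_integral_indicator_countable_UN:
  assumes "f \<in> borel_measurable M" "countable I" "\<And>i. i \<in> I \<Longrightarrow> A i \<in> sets M"
    and "disjoint_family_on A I"
  shows "(\<integral>\<^sup>+w. f w * indicator (\<Union>i\<in>I. A i) w \<partial>M)
    = (\<integral>\<^sup>+i. (\<integral>\<^sup>+w. f w * indicator (A i) w \<partial>M) \<partial>count_space I)"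
proof -
  have U: "(\<Union>i\<in>I. A i) \<in> sets M" by (rule sets.countable_UN''[OF assms(2,3)])
  have "(\<integral>\<^sup>+w. f w * indicator (\<Union>i\<in>I. A i) w \<partial>M) = emeasure (density M f) (\<Union>i\<in>I. A i)"
    using assms U by (simp add: emeasure_density)
  also have "\<dots> = (\<integral>\<^sup>+i. emeasure (density M f) (A i) \<partial>count_space I)"
    using assms by (intro emeasure_UN_countable) auto
  also have "\<dots> = (\<integral>\<^sup>+i. (\<integral>\<^sup>+w. f w * indicator (A i) w \<partial>M) \<partial>count_space I)"
    using assms by (intro nn_integral_cong) (simp add: emeasure_density)
  finally show ?thesis .
qed

text \<open>Splitting the event of one history \<open>h\<close> by the next state, the Markov
  property turns the integral of \<open>f (X (Suc n) w)\<close> into a sum against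
  \<open>P (h n)\<close>, weighted by the measure of the event. Summing over histories later takes
  the place of conditional expectations.\<close>

lemma markov_chain_supermartingale_atom:
  fixes f \<epsilon> :: "'s \<Rightarrow> ennreal"
  assumes mc: "markov_chain M S P x0 X" and S: "countable S"
    and sup: "(\<integral>\<^sup>+y. f y \<partial>measure_pmf (P (h n))) + \<epsilon> (h n) \<le> f (h n)"
    and h: "\<And>i. i \<le> n \<Longrightarrow> h i \<in> S"
  shows "(\<integral>\<^sup>+w. (f (X (Suc n) w) + \<epsilon> (X n w)) * indicator {w \<in> space M. \<forall>i\<le>n. X i w = h i} w \<partial>M)
    \<le> (\<integral>\<^sup>+w. f (X n w) * indicator {w \<in> space M. \<forall>i\<le>n. X i w = h i} w \<partial>M)"
proof -
  interpret prob_space M using mc by (simp add: markov_chain_def)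
  note meas = markov_chain_sets[OF mc S]
  define A where "A = {w \<in> space M. \<forall>i\<le>n. X i w = h i}"
  define B where "B y = {w \<in> space M. (\<forall>i\<le>n. X i w = h i) \<and> X (Suc n) w = y}" for y
  have "A = {w \<in> space M. \<forall>i\<le>n. restrict (\<lambda>i. X i w) {..n} i = h i}"
    by (auto simp: A_def)
  also have "\<dots> \<in> sets M"
    by (rule meas(1)[of "\<lambda>g. \<forall>i\<le>n. g i = h i" n])
  finally have [measurable]: "A \<in> sets M" .
  have B [measurable]: "B y \<in> sets M" for y
  proof -
    have "B y = {w \<in> space M. (\<forall>i\<le>n. restrict (\<lambda>i. X i w) {..Suc n} i = h i)
      \<and> restrict (\<lambda>i. X i w) {..Suc n} (Suc n) = y}"
      by (auto simp: B_def)
    also have "\<dots> \<in> sets M"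
      by (rule meas(1)[of "\<lambda>g. (\<forall>i\<le>n. g i = h i) \<and> g (Suc n) = y" "Suc n"])
    finally show ?thesis .
  qed
  note [measurable] = meas(2)
  have disj: "disjoint_family_on B S"
    by (auto simp: disjoint_family_on_def B_def)
  have AB: "A = (\<Union>y\<in>S. B y)" using meas(3) by (auto simp: A_def B_def)
  have "(\<integral>\<^sup>+w. f (X (Suc n) w) * indicator A w \<partial>M)
    = (\<integral>\<^sup>+y. (\<integral>\<^sup>+w. f (X (Suc n) w) * indicator (B y) w \<partial>M) \<partial>count_space S)"
    unfolding AB by (rule nn_integral_indicator_countable_UN[OF meas(2) S B disj])
  also have "\<dots> = (\<integral>\<^sup>+y. emeasure M A * (ennreal (pmf (P (h n)) y) * f y) \<partial>count_space S)"
  proof (intro nn_integral_cong)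
    fix y assume y: "y \<in> space (count_space S)"
    have "measure M (B y) = measure M A * pmf (P (h n)) y"
      using mc h y unfolding markov_chain_def A_def B_def by simp
    then have BA: "emeasure M (B y) = emeasure M A * ennreal (pmf (P (h n)) y)"
      by (simp add: emeasure_eq_measure ennreal_mult)
    have "(\<integral>\<^sup>+w. f (X (Suc n) w) * indicator (B y) w \<partial>M) = (\<integral>\<^sup>+w. f y * indicator (B y) w \<partial>M)"
      by (intro nn_integral_cong) (auto simp: B_def indicator_def)
    also have "\<dots> = f y * emeasure M (B y)" by (rule nn_integral_cmult_indicator) (rule B)
    finally show "(\<integral>\<^sup>+w. f (X (Suc n) w) * indicator (B y) w \<partial>M)
        = emeasure M A * (ennreal (pmf (P (h n)) y) * f y)"
      by (simp add: BA ac_simps)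
  qed
  also have "\<dots> = emeasure M A * (\<integral>\<^sup>+y. ennreal (pmf (P (h n)) y) * f y \<partial>count_space S)"
    by (intro nn_integral_cmult) auto
  \<comment> \<open>Only an inequality is claimed: the sum over \<open>S\<close> omits any mass that
    \<open>P (h n)\<close> puts outside \<open>S\<close>.\<close>
  also have "\<dots> \<le> emeasure M A * (\<integral>\<^sup>+y. f y \<partial>measure_pmf (P (h n)))"
    by (intro mult_left_mono)
      (auto simp: nn_integral_measure_pmf nn_integral_count_space_indicator indicator_def intro!: nn_integral_mono)
  finally have 1: "(\<integral>\<^sup>+w. f (X (Suc n) w) * indicator A w \<partial>M)
    \<le> emeasure M A * (\<integral>\<^sup>+y. f y \<partial>measure_pmf (P (h n)))" .
  have 2: "(\<integral>\<^sup>+w. g (X n w) * indicator A w \<partial>M) = emeasure M A * g (h n)" for g :: "'s \<Rightarrow> ennreal"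
  proof -
    have "(\<integral>\<^sup>+w. g (X n w) * indicator A w \<partial>M) = (\<integral>\<^sup>+w. g (h n) * indicator A w \<partial>M)"
      by (intro nn_integral_cong) (auto simp: A_def indicator_def)
    also have "\<dots> = emeasure M A * g (h n)"
      by (subst nn_integral_cmult_indicator) (auto simp: mult.commute)
    finally show ?thesis .
  qed
  have "(\<integral>\<^sup>+w. (f (X (Suc n) w) + \<epsilon> (X n w)) * indicator A w \<partial>M)
    = (\<integral>\<^sup>+w. f (X (Suc n) w) * indicator A w \<partial>M) + (\<integral>\<^sup>+w. \<epsilon> (X n w) * indicator A w \<partial>M)"
    by (subst nn_integral_add[symmetric]) (auto simp: distrib_right)
  also have "\<dots> \<le> emeasure M A * ((\<integral>\<^sup>+y. f y \<partial>measure_pmf (P (h n))) + \<epsilon> (h n))"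
    using 1 by (simp add: 2[of \<epsilon>] distrib_left add_right_mono)
  also have "\<dots> \<le> emeasure M A * f (h n)" using sup by (intro mult_left_mono) auto
  also have "\<dots> = (\<integral>\<^sup>+w. f (X n w) * indicator A w \<partial>M)" by (rule 2[symmetric])
  finally show ?thesis by (simp add: A_def)
qed

text \<open>An event of the past is a countable disjoint union of single histories, over which the
  atomic inequality is summed. Allowing any \<open>Q\<close> makes room for stopping.\<close>

lemma markov_chain_supermartingale:
  fixes f \<epsilon> :: "'s \<Rightarrow> ennreal"
  assumes mc: "markov_chain M S P x0 X" and S: "countable S"
    and sup: "\<And>x. x \<in> S \<Longrightarrow> (\<integral>\<^sup>+y. f y \<partial>measure_pmf (P x)) + \<epsilon> x \<le> f x"
    and E: "E = {w \<in> space M. Q (restrict (\<lambda>i. X i w) {..n})}"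
  shows "(\<integral>\<^sup>+w. (f (X (Suc n) w) + \<epsilon> (X n w)) * indicator E w \<partial>M)
    \<le> (\<integral>\<^sup>+w. f (X n w) * indicator E w \<partial>M)"
proof -
  note meas = markov_chain_sets[OF mc S]
  note [measurable] = meas(2)
  define A where "A h = {w \<in> space M. \<forall>i\<le>n. X i w = h i}" for h
  have A: "A h \<in> sets M" for h
  proof -
    have "A h = {w \<in> space M. \<forall>i\<le>n. restrict (\<lambda>i. X i w) {..n} i = h i}"
      by (auto simp: A_def)
    also have "\<dots> \<in> sets M"
      by (rule meas(1)[of "\<lambda>g. \<forall>i\<le>n. g i = h i" n])
    finally show ?thesis .
  qed
  let ?I = "{h \<in> {..n} \<rightarrow>\<^sub>E S. Q h}"
  have ci: "countable ?I"
    by (rule countable_subset[of _ "{..n} \<rightarrow>\<^sub>E S"]) (use S in \<open>auto intro: countable_PiE\<close>)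
  have A_eq: "h = restrict (\<lambda>i. X i w) {..n}" if "w \<in> A h" "h \<in> {..n} \<rightarrow>\<^sub>E S" for w h
    using that by (intro ext) (auto simp: A_def PiE_def extensional_def restrict_def)
  then have disj: "disjoint_family_on A ?I"
    unfolding disjoint_family_on_def by blast
  have EA: "E = (\<Union>h\<in>?I. A h)"
  proof (intro equalityI subsetI)
    fix w assume "w \<in> E"
    then show "w \<in> (\<Union>h\<in>?I. A h)" using meas(3)
      by (intro UN_I[of "restrict (\<lambda>i. X i w) {..n}"]) (auto simp: E A_def)
  next
    fix w assume "w \<in> (\<Union>h\<in>?I. A h)"
    then obtain h where h: "h \<in> ?I" "w \<in> A h" by blast
    with A_eq[of w h] have "restrict (\<lambda>i. X i w) {..n} = h" by simp
    with h show "w \<in> E" by (simp add: E A_def)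
  qed
  have split: "(\<integral>\<^sup>+w. \<phi> w * indicator E w \<partial>M)
    = (\<integral>\<^sup>+h. (\<integral>\<^sup>+w. \<phi> w * indicator (A h) w \<partial>M) \<partial>count_space ?I)"
    if "\<phi> \<in> borel_measurable M" for \<phi>
    unfolding EA using that ci A disj by (intro nn_integral_indicator_countable_UN) auto
  show ?thesis
    unfolding split[OF borel_measurable_add[OF meas(2)[of f] meas(2)]] split[OF meas(2)]
  proof (rule nn_integral_mono)
    fix h assume "h \<in> space (count_space ?I)"
    then have "h i \<in> S" if "i \<le> n" for i using that by auto
    then show "(\<integral>\<^sup>+w. (f (X (Suc n) w) + \<epsilon> (X n w)) * indicator (A h) w \<partial>M)
        \<le> (\<integral>\<^sup>+w. f (X n w) * indicator (A h) w \<partial>M)"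
      unfolding A_def using mc S sup by (intro markov_chain_supermartingale_atom[where P=P and S=S]) auto
  qed
qed

lemma markov_chain_initial_nn_integral:
  fixes f :: "'s \<Rightarrow> ennreal"
  assumes "markov_chain M S P x0 X"
  shows "(\<integral>\<^sup>+w. f (X 0 w) \<partial>M) = f x0"
proof -
  interpret prob_space M using assms by (simp add: markov_chain_def)
  have "AE w in M. X 0 w = x0" using assms by (simp add: markov_chain_def)
  then have "(\<integral>\<^sup>+w. f (X 0 w) \<partial>M) = (\<integral>\<^sup>+w. f x0 \<partial>M)"
    by (intro nn_integral_cong_AE) auto
  then show ?thesis by (simp add: emeasure_space_1)
qed

section \<open>Leaving finite sets for good\<close>

text \<open>The expected decrements \<open>\<epsilon> (X n w)\<close> telescope to at most
  \<open>f x0\<close>, so their sum is almost surely finite. Infinitely many visits to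
  \<open>F\<close> would make it diverge, as \<epsilon> has a positive minimum on \<open>F\<close>.
  The null set does not depend on \<open>F\<close>.\<close>

lemma markov_chain_finitely_many_visits:
  fixes f :: "'s \<Rightarrow> ennreal"
  assumes mc: "markov_chain M S P x0 X" and S: "countable S"
    and fin: "f x0 < \<infinity>"
    and sup: "\<And>x. x \<in> S \<Longrightarrow> (\<integral>\<^sup>+y. f y \<partial>measure_pmf (P x)) < f x"
  shows "AE w in M. \<forall>F. finite F \<and> F \<subseteq> S \<longrightarrow> (\<forall>\<^sub>F n in sequentially. X n w \<notin> F)"
proof -
  note [measurable] = markov_chain_sets(2)[OF mc S]
  define \<epsilon> where "\<epsilon> x = f x - (\<integral>\<^sup>+y. f y \<partial>measure_pmf (P x))" for x
  have pos: "\<epsilon> x > 0" if "x \<in> S" for x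
    unfolding \<epsilon>_def using sup[OF that] by (rule diff_gr0_ennreal)
  have dec: "(\<integral>\<^sup>+y. f y \<partial>measure_pmf (P x)) + \<epsilon> x \<le> f x" if "x \<in> S" for x
    unfolding \<epsilon>_def using sup[OF that] by (simp add: add_diff_inverse_ennreal less_imp_le)
  have step: "(\<integral>\<^sup>+w. f (X (Suc n) w) \<partial>M) + (\<integral>\<^sup>+w. \<epsilon> (X n w) \<partial>M) \<le> (\<integral>\<^sup>+w. f (X n w) \<partial>M)" for n
  proof -
    have "(\<integral>\<^sup>+w. (f (X (Suc n) w) + \<epsilon> (X n w)) * indicator (space M) w \<partial>M)
      \<le> (\<integral>\<^sup>+w. f (X n w) * indicator (space M) w \<partial>M)"
      by (rule markov_chain_supermartingale[OF mc S dec, where Q = "\<lambda>_. True"]) auto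
    moreover have "(\<integral>\<^sup>+w. g w * indicator (space M) w \<partial>M) = (\<integral>\<^sup>+w. g w \<partial>M)" for g :: "_ \<Rightarrow> ennreal"
      by (intro nn_integral_cong) simp
    ultimately show ?thesis by (simp add: nn_integral_add)
  qed
  have part: "(\<integral>\<^sup>+w. f (X N w) \<partial>M) + (\<Sum>n<N. \<integral>\<^sup>+w. \<epsilon> (X n w) \<partial>M) \<le> f x0" for N
  proof (induction N)
    case 0
    then show ?case by (simp add: markov_chain_initial_nn_integral[OF mc])
  next
    case (Suc N)
    have "(\<integral>\<^sup>+w. f (X (Suc N) w) \<partial>M) + (\<Sum>n<Suc N. \<integral>\<^sup>+w. \<epsilon> (X n w) \<partial>M)
      = ((\<integral>\<^sup>+w. f (X (Suc N) w) \<partial>M) + (\<integral>\<^sup>+w. \<epsilon> (X N w) \<partial>M)) + (\<Sum>n<N. \<integral>\<^sup>+w. \<epsilon> (X n w) \<partial>M)"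
      by (simp add: ac_simps)
    also have "\<dots> \<le> (\<integral>\<^sup>+w. f (X N w) \<partial>M) + (\<Sum>n<N. \<integral>\<^sup>+w. \<epsilon> (X n w) \<partial>M)"
      by (intro add_right_mono step)
    finally show ?case using Suc.IH by (rule order.trans)
  qed
  have "(\<Sum>n<N. \<integral>\<^sup>+w. \<epsilon> (X n w) \<partial>M) \<le> f x0" for N
    by (rule order.trans[OF _ part[of N]]) simp
  then have "(\<Sum>n. \<integral>\<^sup>+w. \<epsilon> (X n w) \<partial>M) \<le> f x0"
    by (intro suminf_le_const) auto
  then have "(\<integral>\<^sup>+w. (\<Sum>n. \<epsilon> (X n w)) \<partial>M) < \<infinity>"
    using fin by (simp add: nn_integral_suminf)
  then have "AE w in M. (\<Sum>n. \<epsilon> (X n w)) \<noteq> \<infinity>"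
    by (intro nn_integral_PInf_AE) auto
  then show ?thesis
  proof (eventually_elim, intro allI impI)
    fix w F
    assume sm: "(\<Sum>n. \<epsilon> (X n w)) \<noteq> \<infinity>" and F: "finite F \<and> F \<subseteq> S"
    show "\<forall>\<^sub>F n in sequentially. X n w \<notin> F"
    proof (cases "F = {}")
      case False
      \<comment> \<open>Inserting 1 keeps \<open>c\<close> finite even where \<epsilon> is
        infinite.\<close>
      define c where "c = Min (insert 1 (\<epsilon> ` F))"
      have "c \<le> 1" using F by (simp add: c_def)
      then have "c \<noteq> \<infinity>" by (auto simp: top_unique)
      moreover have "c > 0" and c_le: "x \<in> F \<Longrightarrow> c \<le> \<epsilon> x" for x
        using F pos by (auto simp: c_def)
      ultimately have c: "c > 0" "c \<noteq> \<infinity>" by auto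
      show ?thesis
      proof (rule ccontr)
        assume "\<not> ?thesis"
        then have inf: "infinite {n. X n w \<in> F}"
          by (simp add: not_eventually cofinite_eq_sequentially[symmetric] frequently_cofinite)
        have "of_nat N * c \<le> (\<Sum>n. \<epsilon> (X n w))" for N
        proof -
          obtain T where T: "T \<subseteq> {n. X n w \<in> F}" "finite T" "card T = N"
            using inf infinite_arbitrarily_large by blast
          have "of_nat N * c = (\<Sum>n\<in>T. c)" using T by simp
          also have "\<dots> \<le> (\<Sum>n\<in>T. \<epsilon> (X n w))" using T c_le by (intro sum_mono) auto
          also have "\<dots> \<le> (\<Sum>n. \<epsilon> (X n w))" using T by (intro sum_le_suminf) auto
          finally show ?thesis .
        qed
        moreover have "(SUP N::nat. of_nat N * c) = \<infinity>"
          using c by (simp add: SUP_mult_right_ennreal[symmetric] ennreal_SUP_of_nat_eq_top ennreal_top_mult)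
        ultimately have "\<infinity> \<le> (\<Sum>n. \<epsilon> (X n w))"
          by (metis SUP_least)
        with sm show False by (simp add: top_unique)
      qed
    qed simp
  qed
qed

section \<open>Maximal inequality and boundedness\<close>

text \<open>Replacing the process by the constant \<open>K\<close> once it has reached level
  \<open>K\<close> cannot increase its expectation, which starts at \<open>f x0\<close>.\<close>

lemma markov_chain_maximal:
  fixes f :: "'s \<Rightarrow> ennreal"
  assumes mc: "markov_chain M S P x0 X" and S: "countable S"
    and sup: "\<And>x. x \<in> S \<Longrightarrow> (\<integral>\<^sup>+y. f y \<partial>measure_pmf (P x)) \<le> f x"
  shows "K * emeasure M {w \<in> space M. \<exists>n. K \<le> f (X n w)} \<le> f x0"
proof -
  note meas [measurable] = markov_chain_sets(2)[OF mc S]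
  define B where "B n = {w \<in> space M. \<exists>i<n. K \<le> f (X i w)}" for n
  define G where "G n = {w \<in> space M. \<forall>i<n. f (X i w) < K}" for n
  have [measurable]: "B n \<in> sets M" "G n \<in> sets M" for n
    unfolding B_def G_def by measurable
  \<comment> \<open>\<open>G n\<close> and \<open>B n\<close> look only at times before
    \<open>n\<close>: at the hitting time itself the integrand is still \<open>f (X n w)\<close>,
    and it drops to \<open>K\<close> one step later. Hence \<open>G (Suc n)\<close> is an event of
    the history up to \<open>n\<close>.\<close>
  define V where "V n = (\<integral>\<^sup>+w. f (X n w) * indicator (G n) w + K * indicator (B n) w \<partial>M)" for n
  have "V (Suc n) \<le> V n" for n
  proof -
    have "(\<integral>\<^sup>+w. (f (X (Suc n) w) + 0) * indicator (G (Suc n)) w \<partial>M)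
      \<le> (\<integral>\<^sup>+w. f (X n w) * indicator (G (Suc n)) w \<partial>M)"
      by (rule markov_chain_supermartingale[OF mc S, where Q = "\<lambda>h. \<forall>i\<le>n. f (h i) < K" and \<epsilon> = "\<lambda>_. 0"])
        (use sup in \<open>auto simp: G_def less_Suc_eq_le\<close>)
    then have "V (Suc n) \<le> (\<integral>\<^sup>+w. f (X n w) * indicator (G (Suc n)) w + K * indicator (B (Suc n)) w \<partial>M)"
      unfolding V_def by (simp add: nn_integral_add add_right_mono)
    also have "\<dots> \<le> V n"
      unfolding V_def
    proof (intro nn_integral_mono)
      fix w assume w: "w \<in> space M"
      show "f (X n w) * indicator (G (Suc n)) w + K * indicator (B (Suc n)) w
        \<le> f (X n w) * indicator (G n) w + K * indicator (B n) w"
      proof (cases "w \<in> G n")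
        case True
        then show ?thesis using w
          by (cases "K \<le> f (X n w)") (auto simp: G_def B_def less_Suc_eq not_le indicator_def)
      next
        case False
        then have "w \<in> B n" "w \<notin> G (Suc n)" using w by (auto simp: G_def B_def not_le not_less less_Suc_eq)
        then show ?thesis by (simp add: mult_left_le indicator_def)
      qed
    qed
    finally show ?thesis .
  qed
  then have "V n \<le> V 0" for n by (rule lift_Suc_antimono_le) simp
  moreover have "V 0 = f x0"
  proof -
    have "V 0 = (\<integral>\<^sup>+w. f (X 0 w) \<partial>M)"
      unfolding V_def by (intro nn_integral_cong) (simp add: G_def B_def)
    then show ?thesis by (simp add: markov_chain_initial_nn_integral[OF mc])
  qed
  moreover have "K * emeasure M (B n) \<le> V n" for n
  proof -
    have "K * emeasure M (B n) = (\<integral>\<^sup>+w. K * indicator (B n) w \<partial>M)"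
      by (simp add: nn_integral_cmult_indicator)
    also have "\<dots> \<le> V n" unfolding V_def by (intro nn_integral_mono) simp
    finally show ?thesis .
  qed
  ultimately have "K * emeasure M (B n) \<le> f x0" for n by (metis order.trans)
  then have "(SUP n. K * emeasure M (B n)) \<le> f x0" by (rule SUP_least)
  moreover have "(SUP n. K * emeasure M (B n)) = K * emeasure M (\<Union>n. B n)"
    by (subst SUP_emeasure_incseq[symmetric])
      (auto simp: SUP_mult_left_ennreal incseq_def B_def[abs_def] intro: less_le_trans)
  moreover have "(\<Union>n. B n) = {w \<in> space M. \<exists>n. K \<le> f (X n w)}"
    by (auto simp: B_def)
  ultimately show ?thesis by simp
qed

text \<open>By the maximal inequality, level \<open>k\<close> is reached with probability at most
  \<open>max 0 (f x0) / k\<close>; the event \<open>N\<close> of unboundedness lies below this for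
  every positive \<open>k\<close>.\<close>

lemma markov_chain_supermartingale_bounded:
  fixes f :: "'s \<Rightarrow> real"
  assumes mc: "markov_chain M S P x0 X" and S: "countable S"
    and sup: "\<And>x. x \<in> S \<Longrightarrow> (\<integral>\<^sup>+y. ennreal (f y) \<partial>measure_pmf (P x)) \<le> ennreal (f x)"
  shows "AE w in M. \<exists>K. \<forall>n. f (X n w) \<le> K"
proof -
  note [measurable] = markov_chain_sets(2)[OF mc S, where g = "\<lambda>x. ennreal (f x)"]
  interpret prob_space M using mc by (simp add: markov_chain_def)
  define N where "N = {w \<in> space M. \<forall>k::nat. \<exists>n. ennreal (real k) \<le> ennreal (f (X n w))}"
  have N [measurable]: "N \<in> sets M" unfolding N_def by measurable
  have le: "real k * measure M N \<le> max 0 (f x0)" for k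
  proof -
    have "ennreal (real k) * emeasure M N
      \<le> ennreal (real k) * emeasure M {w \<in> space M. \<exists>n. ennreal (real k) \<le> ennreal (f (X n w))}"
      by (intro mult_left_mono emeasure_mono) (auto simp: N_def)
    also have "\<dots> \<le> ennreal (f x0)"
      by (rule markov_chain_maximal[OF mc S]) (rule sup)
    also have "\<dots> = ennreal (max 0 (f x0))" by (simp add: max_def ennreal_neg)
    finally have "ennreal (real k * measure M N) \<le> ennreal (max 0 (f x0))"
      by (simp add: emeasure_eq_measure ennreal_mult)
    then show ?thesis by (subst (asm) ennreal_le_iff) auto
  qed
  have "measure M N = 0"
  proof (rule ccontr)
    assume "measure M N \<noteq> 0"
    then have "measure M N > 0" by (simp add: zero_less_measure_iff)
    then obtain k where "max 0 (f x0) < real k * measure M N"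
      using ex_less_of_nat_mult by blast
    with le[of k] show False by simp
  qed
  then have "AE w in M. w \<notin> N" using N by (simp add: AE_iff_null_sets[symmetric] emeasure_eq_measure null_sets_def AE_not_in)
  with AE_space show ?thesis
  proof eventually_elim
    case (elim w)
    then obtain k where k: "\<And>n. ennreal (f (X n w)) < ennreal (real k)"
      by (auto simp: N_def not_le)
    have "f (X n w) \<le> real k" for n
    proof (rule ccontr)
      assume "\<not> f (X n w) \<le> real k"
      then have "ennreal (real k) \<le> ennreal (f (X n w))" by (intro ennreal_leI) simp
      with k[of n] show False by simp
    qed
    then show ?case by blast
  qed
qed

subsection \<open>The walk on the dyadic rationals\<close>

text \<open>For dyadic \<open>x\<close> the reduced denominator is \<open>2 ^ level x\<close>, so
  this is the depth of the coset of \<open>x\<close> in the tree.\<close>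

definition level :: "real \<Rightarrow> nat" where
  "level x = (LEAST n. x * 2 ^ n \<in> \<int>)"

text \<open>
  At depth \<open>n\<close> the superharmonic function takes the values \<open>100 q\<close> and \<open>92 q\<close>, \<open>q = (4/5) ^ n\<close>, at
  \<open>\<theta>\<close> and \<open>\<theta> + 1\<close>. The constants are chosen such that
  \<open>101 + 92 + 100 * 4/5 + 100 * 5/4 < 4 * 100\<close> at \<open>\<theta>\<close> (for the worse of the two possible parents) and
  \<open>100 + 2 * 93 + 100 * 4/5 < 4 * 92\<close> at \<open>\<theta> + 1\<close>.
  The square roots give strict concavity along the half-lines.
\<close>

definition profile :: "int \<Rightarrow> real" where
  "profile k = (if k \<le> 0 then 100 + sqrt (of_int (- k)) else 92 + sqrt (of_int (k - 1)))"

text \<open>The floor is the position in the coset, counted from its representative in [0,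
  1).\<close>

definition lyap :: "real \<Rightarrow> real" where
  "lyap x = (4/5) ^ level x * profile \<lfloor>x\<rfloor>"

lemma dyadic_rats_level: "x \<in> dyadic_rats \<Longrightarrow> \<exists>n. x * 2 ^ n \<in> \<int>"
  unfolding dyadic_rats_def by clarsimp (metis Ints_of_int nonzero_eq_divide_eq power_not_zero zero_neq_numeral)

lemma level_plus_minus_1 [simp]:
  "level (x + 1) = level x" "level (x - 1) = level x"
proof -
  have "(x + 1) * 2 ^ n \<in> \<int> \<longleftrightarrow> x * 2 ^ n \<in> \<int>" "(x - 1) * 2 ^ n \<in> \<int> \<longleftrightarrow> x * 2 ^ n \<in> \<int>" for n :: nat
  proof -
    have e: "(x + 1) * 2 ^ n = x * 2 ^ n + of_int (2 ^ n)" "(x - 1) * 2 ^ n = x * 2 ^ n - of_int (2 ^ n)"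
      by (simp_all add: algebra_simps)
    show "(x + 1) * 2 ^ n \<in> \<int> \<longleftrightarrow> x * 2 ^ n \<in> \<int>" "(x - 1) * 2 ^ n \<in> \<int> \<longleftrightarrow> x * 2 ^ n \<in> \<int>"
      unfolding e by (metis Ints_add Ints_diff Ints_of_int add_diff_cancel diff_add_cancel)+
  qed
  then show "level (x + 1) = level x" "level (x - 1) = level x" by (simp_all add: level_def)
qed

text \<open>The integrality condition for \<open>x / 2\<close> is that for \<open>x\<close> shifted
  by one. The second hypothesis excludes even integers, where the level stays 0.\<close>

lemma level_half:
  assumes "x \<in> dyadic_rats" "x / 2 \<notin> \<int>"
  shows "level (x / 2) = Suc (level x)"
proof -
  obtain n where n: "x * 2 ^ n \<in> \<int>" using dyadic_rats_level[OF assms(1)] by blast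
  show ?thesis unfolding level_def
    by (rule Least_Suc2[where n = "Suc n" and m = n]) (use assms n in auto)
qed

text \<open>After squaring, this is \<open>sqrt (t\<^sup>2 - 1) < t\<close>.\<close>

lemma sqrt_strict_concave:
  fixes t :: real
  assumes "1 \<le> t"
  shows "sqrt (t + 1) + sqrt (t - 1) < 2 * sqrt t"
proof -
  have "sqrt (t + 1) * sqrt (t - 1) = sqrt (t\<^sup>2 - 1)"
    by (simp add: real_sqrt_mult[symmetric] power2_eq_square algebra_simps)
  also have "\<dots> < sqrt (t\<^sup>2)" by (rule real_sqrt_less_mono) simp
  also have "\<dots> = t" using assms by simp
  finally have "(sqrt (t + 1) + sqrt (t - 1))\<^sup>2 < (2 * sqrt t)\<^sup>2"
    using assms by (simp add: power2_sum power_mult_distrib)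
  then show ?thesis by (rule power2_less_imp_less) (use assms in simp)
qed

text \<open>Away from the endpoints 0 and 1 of the half-lines, \<open>k\<close> and both neighbours
  lie on the same square root branch.\<close>

lemma profile_concave:
  assumes "k < 0 \<or> 1 < k"
  shows "profile (k - 1) + profile (k + 1) < 2 * profile k"
proof (cases "k < 0")
  case True
  then show ?thesis using sqrt_strict_concave[of "of_int (- k)"]
    by (simp add: profile_def algebra_simps minus_diff_commute)
next
  case False
  then show ?thesis using assms sqrt_strict_concave[of "of_int (k - 1)"]
    by (simp add: profile_def)
qed

lemma profile_ge: "profile k \<ge> 92"
  by (auto simp: profile_def)

lemma profile_simps: "profile 0 = 100" "profile 1 = 92" "profile 2 = 93" "profile (-1) = 101"
  by (auto simp: profile_def)

lemma lyap_nonneg: "lyap x \<ge> 0"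
  using profile_ge[of "\<lfloor>x\<rfloor>"] by (simp add: lyap_def)

text \<open>Inside a half-line, \<open>tB\<close> and its inverse either fix the point or repeat the
  moves of \<open>tA\<close> and its inverse, so concavity of the profile suffices. The points of
  [0, 2) are settled by the numerical choice of the constants.\<close>

lemma lyap_superharmonic:
  assumes x: "x \<in> dyadic_rats"
  shows "lyap (tA x) + lyap (inv tA x) + lyap (tB x) + lyap (inv tB x) < 4 * lyap x"
proof -
  define r :: real where "r = (4/5) ^ level x"
  have r: "r > 0" by (simp add: r_def)
  have l0: "lyap x = r * profile \<lfloor>x\<rfloor>" by (simp add: lyap_def r_def)
  have l1: "lyap (x + 1) = r * profile (\<lfloor>x\<rfloor> + 1)" "lyap (x - 1) = r * profile (\<lfloor>x\<rfloor> - 1)"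
    by (simp_all add: lyap_def r_def)
  \<comment> \<open>Halving a point of (0, 2) enters a child coset at its representative in (0, 1),
    hence the factor \<open>100 * 4/5\<close>.\<close>
  have up: "lyap (x / 2) = r * 80" if "0 < x" "x < 2"
  proof -
    have fl: "\<lfloor>x / 2\<rfloor> = 0" using that by (simp add: floor_eq_iff)
    have "x / 2 \<notin> \<int>" using that fl by (metis Ints_cases floor_of_int of_int_0 less_numeral_extra(3) half_gt_zero)
    then show ?thesis by (simp add: lyap_def level_half[OF x] fl r_def profile_simps)
  qed
  consider (neg) "x < 0" | (zero) "x = 0" | (low) "0 < x" "x < 1" | (mid) "1 \<le> x" "x < 2" | (high) "2 \<le> x"
    by linarith
  then show ?thesis
  proof cases
    case neg
    then have "\<lfloor>x\<rfloor> < 0" by simp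
    then have "r * (profile (\<lfloor>x\<rfloor> - 1) + profile (\<lfloor>x\<rfloor> + 1)) < r * (2 * profile \<lfloor>x\<rfloor>)"
      using r by (intro mult_strict_left_mono profile_concave) auto
    moreover have "tA x = x - 1" "inv tA x = x + 1" "tB x = x" "inv tB x = x"
      using neg by (simp_all add: inv_tA inv_tB tA_def tB_def)
    ultimately show ?thesis by (simp only: l0 l1) (simp add: algebra_simps)
  next
    \<comment> \<open>Here \<open>tB\<close> and its inverse give loops, and the inequality reads
      \<open>101 + 92 + 2 * 100 < 4 * 100\<close>.\<close>
    case zero
    have "tA x = x - 1" "inv tA x = x + 1" "tB x = x" "inv tB x = x"
      using zero by (simp_all add: inv_tA inv_tB tA_def tB_def)
    moreover have "\<lfloor>x\<rfloor> = 0" using zero by simp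
    ultimately show ?thesis using r by (simp only: l0 l1) (simp add: profile_simps)
  next
    case low
    have fl: "\<lfloor>x\<rfloor> = 0" using low by (simp add: floor_eq_iff)
    have "x \<notin> \<int>" using low fl by (metis Ints_cases floor_of_int of_int_0 less_numeral_extra(3))
    moreover have "2 * x \<in> dyadic_rats"
      using gens_dyadic_rats[OF _ x, of "inv tB"] low by (simp add: gens_def inv_tB)
    ultimately have "level x = Suc (level (2 * x))" using level_half[of "2 * x"] by simp
    then have "(4/5) ^ level (2 * x) = r * (5/4)" by (simp add: r_def)
    moreover have "\<lfloor>2 * x\<rfloor> = 0 \<or> \<lfloor>2 * x\<rfloor> = 1" using low by (simp add: floor_eq_iff) linarith
    \<comment> \<open>The value at the parent is \<open>r * 5/4\<close> times 100 or 92, according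
      to the floor; 125 covers both.\<close>
    ultimately have "lyap (2 * x) \<le> r * 125" using r by (auto simp: lyap_def profile_simps)
    moreover have "tA x = x - 1" "inv tA x = x + 1" "tB x = x / 2" "inv tB x = 2 * x"
      using low by (simp_all add: inv_tA inv_tB tA_def tB_def)
    ultimately show ?thesis using low up r by (simp only: l0 l1 fl) (simp add: profile_simps)
  next
    case mid
    have fl: "\<lfloor>x\<rfloor> = 1" using mid by (simp add: floor_eq_iff)
    have "tA x = x - 1" "inv tA x = x + 1" "tB x = x / 2" "inv tB x = x + 1"
      using mid by (auto simp: inv_tA inv_tB tA_def tB_def)
    then show ?thesis using mid up r by (simp only: l0 l1 fl) (simp add: profile_simps)
  next
    case high
    then have "1 < \<lfloor>x\<rfloor>" by linarith
    then have "r * (profile (\<lfloor>x\<rfloor> - 1) + profile (\<lfloor>x\<rfloor> + 1)) < r * (2 * profile \<lfloor>x\<rfloor>)"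
      using r by (intro mult_strict_left_mono profile_concave) auto
    moreover have "tA x = x - 1" "inv tA x = x + 1" "tB x = x - 1" "inv tB x = x + 1"
      using high by (auto simp: inv_tA inv_tB tA_def tB_def)
    ultimately show ?thesis by (simp only: l0 l1) (simp add: algebra_simps)
  qed
qed

lemma lyap_schreier_step:
  assumes "x \<in> dyadic_rats"
  shows "(\<integral>\<^sup>+y. ennreal (lyap y) \<partial>measure_pmf (schreier_step gens x)) < ennreal (lyap x)"
proof -
  have "(\<integral>\<^sup>+y. ennreal (lyap y) \<partial>measure_pmf (schreier_step gens x)) = (\<Sum>g\<in>gens. ennreal (lyap (g x))) / 4"
    using nn_integral_pmf_of_set[of gens] by (simp add: schreier_step_def card_gens) (simp add: gens_def)
  also have "\<dots> = ennreal ((\<Sum>g\<in>gens. lyap (g x)) / 4)"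
    using divide_ennreal[of "\<Sum>g\<in>gens. lyap (g x)" 4] by (simp add: lyap_nonneg sum_nonneg)
  also have "(\<Sum>g\<in>gens. lyap (g x)) = lyap (tA x) + lyap (inv tA x) + lyap (tB x) + lyap (inv tB x)"
    using gens_distinct unfolding gens_def by (subst sum.insert; simp)+
  also have "ennreal (\<dots> / 4) < ennreal (lyap x)"
    using lyap_superharmonic[OF assms] by (simp add: ennreal_less_iff lyap_nonneg)
  finally show ?thesis .
qed

section \<open>From bounded superharmonic values to the 2-adic norm\<close>

text \<open>Depth at most \<open>L\<close> keeps the geometric factor above
  \<open>(4/5) ^ L\<close>, so the bound \<open>K\<close> limits the profile and thereby the floor.
  What remains are multiples of \<open>1 / 2 ^ L\<close> in a bounded interval.\<close>

lemma finite_lyap_sublevel: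
  "finite {x \<in> dyadic_rats. x * 2 ^ L \<in> \<int> \<and> lyap x \<le> K}"
proof -
  define C where "C = max 0 (K * (5/4) ^ L)"
  \<comment> \<open>On the right half-line the floor is at most \<open>C\<^sup>2 + 1\<close>, so
    \<open>x\<close> is below \<open>C\<^sup>2 + 2\<close>; the left half-line needs less.\<close>
  define N where "N = \<lceil>C\<^sup>2\<rceil> + 2"
  have "x \<in> (\<lambda>m. of_int m / 2 ^ L) ` {- N * 2 ^ L..N * 2 ^ L}"
    if x: "x \<in> dyadic_rats" "x * 2 ^ L \<in> \<int>" "lyap x \<le> K" for x :: real
  proof -
    have "level x \<le> L" unfolding level_def using x(2) by (rule Least_le)
    then have "(4/5) ^ L \<le> (4/5::real) ^ level x" by (intro power_decreasing) auto
    then have "(4/5) ^ L * profile \<lfloor>x\<rfloor> \<le> K"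
      using x(3) profile_ge[of "\<lfloor>x\<rfloor>"] unfolding lyap_def
      by (smt (verit) mult_right_mono)
    then have "(4/5) ^ L * profile \<lfloor>x\<rfloor> * (5/4) ^ L \<le> K * (5/4) ^ L"
      by (intro mult_right_mono) auto
    moreover have "(4/5) ^ L * (5/4) ^ L = (1::real)" by (simp add: power_mult_distrib[symmetric])
    moreover have "(4/5) ^ L * profile \<lfloor>x\<rfloor> * (5/4) ^ L = (4/5) ^ L * (5/4) ^ L * profile \<lfloor>x\<rfloor>"
      by (simp only: ac_simps)
    ultimately have "profile \<lfloor>x\<rfloor> \<le> C" by (simp add: C_def)
    then have q: "sqrt (of_int (- \<lfloor>x\<rfloor>)) \<le> C \<or> \<lfloor>x\<rfloor> > 0" "sqrt (of_int (\<lfloor>x\<rfloor> - 1)) \<le> C \<or> \<lfloor>x\<rfloor> \<le> 0"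
      by (auto simp: profile_def split: if_splits)
    have sq: "of_int j \<le> C\<^sup>2" if "sqrt (of_int j) \<le> C" "j \<ge> 0" for j :: int
      using that(1) by (rule sqrt_le_D)
    have C2: "C\<^sup>2 \<le> of_int \<lceil>C\<^sup>2\<rceil>" "0 \<le> \<lceil>C\<^sup>2\<rceil>"
      using less_le_trans[of "-1" 0 "C\<^sup>2"] by auto
    have "\<bar>x\<bar> \<le> of_int N"
    proof (cases "\<lfloor>x\<rfloor> \<le> 0")
      case True
      then have "of_int (- \<lfloor>x\<rfloor>) \<le> C\<^sup>2" using q sq[of "- \<lfloor>x\<rfloor>"] by auto
      then show ?thesis using True C2 unfolding N_def by simp linarith
    next
      case False
      then have "of_int (\<lfloor>x\<rfloor> - 1) \<le> C\<^sup>2" using q sq[of "\<lfloor>x\<rfloor> - 1"] by auto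
      then show ?thesis using False C2 unfolding N_def by simp linarith
    qed
    then have "\<bar>x * 2 ^ L\<bar> \<le> of_int (N * 2 ^ L)" by (simp add: abs_mult)
    moreover obtain m where m: "x * 2 ^ L = of_int m" using x(2) by (auto elim: Ints_cases)
    ultimately have "\<bar>m\<bar> \<le> N * 2 ^ L" by (metis of_int_abs of_int_le_iff)
    moreover have "x = of_int m / 2 ^ L" using m by (simp add: field_simps)
    ultimately show ?thesis by (intro image_eqI[of _ _ m]) auto
  qed
  then have "{x \<in> dyadic_rats. x * 2 ^ L \<in> \<int> \<and> lyap x \<le> K} \<subseteq> (\<lambda>m. of_int m / 2 ^ L) ` {- N * 2 ^ L..N * 2 ^ L}"
    by blast
  then show ?thesis by (rule finite_subset) simp
qed

text \<open>If \<open>x\<close> is an odd integer times \<open>2 powi n\<close>, then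
  \<open>x * 2 ^ L\<close> fails to be an integer only when \<open>n + L < 0\<close>, and the norm
  is \<open>2 powi (- n)\<close>.\<close>

lemma norm2_gt:
  assumes "x \<in> dyadic_rats" "x * 2 ^ L \<notin> \<int>"
  shows "2 ^ L < norm2 x"
proof -
  obtain m :: int and k :: nat where x: "x = of_int m / 2 ^ k"
    using assms(1) by (auto simp: dyadic_rats_def)
  have "m \<noteq> 0" using assms(2) x by auto
  then obtain e p where m: "m = 2 ^ e * p" and "odd p"
    by (rule multiplicity_decompose'[of m 2]) auto
  then obtain q where q: "p = 2 * q + 1" by (auto elim: oddE)
  define n where "n = int e - int k"
  have xn: "x = of_int (2 * q + 1) * 2 powi n"
    unfolding x m n_def q by (simp add: power_int_diff)
  have "n + int L < 0"
  proof (rule ccontr)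
    assume "\<not> ?thesis"
    then have j: "n + int L = int (nat (n + int L))" by simp
    have "x * 2 ^ L = of_int (2 * q + 1) * 2 powi (n + int L)"
      unfolding xn by (simp add: power_int_add)
    also have "\<dots> = of_int ((2 * q + 1) * 2 ^ nat (n + int L))"
      by (subst j) (simp only: power_int_of_nat of_int_mult of_int_power of_int_numeral)
    finally have "x * 2 ^ L = of_int ((2 * q + 1) * 2 ^ nat (n + int L))" .
    with assms(2) show False by (metis Ints_of_int)
  qed
  then have "(2::real) powi int L < 2 powi (- n)" by (intro power_int_strict_increasing) auto
  then show ?thesis by (simp add: xn norm2_odd_times_power del: of_int_add of_int_mult)
qed

lemma countable_dyadic_rats: "countable dyadic_rats"
proof -
  have "dyadic_rats = (\<lambda>(m::int, k::nat). of_int m / 2 ^ k) ` UNIV"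
    by (auto simp: dyadic_rats_def)
  then show ?thesis by (metis countable_image countableI_type)
qed

theorem theorem13:
  fixes M :: "'w measure" and X :: "nat \<Rightarrow> 'w \<Rightarrow> real"
  assumes "markov_chain M dyadic_rats (schreier_step gens) 0 X"
  shows "AE w in M. filterlim (\<lambda>n. norm2 (X n w)) at_top sequentially"
proof -
  note D = countable_dyadic_rats
  have "AE w in M. \<forall>F. finite F \<and> F \<subseteq> dyadic_rats \<longrightarrow> (\<forall>\<^sub>F n in sequentially. X n w \<notin> F)"
    by (rule markov_chain_finitely_many_visits[OF assms D _ lyap_schreier_step]) simp
  moreover have "AE w in M. \<exists>K. \<forall>n. lyap (X n w) \<le> K"
    by (rule markov_chain_supermartingale_bounded[OF assms D less_imp_le[OF lyap_schreier_step]])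
  moreover have "AE w in M. \<forall>n. X n w \<in> dyadic_rats"
    using markov_chain_sets(3)[OF assms D] by (intro AE_I2) blast
  ultimately show ?thesis
  proof eventually_elim
    case (elim w)
    then obtain K where K: "\<And>n. lyap (X n w) \<le> K" by blast
    show ?case
      unfolding filterlim_at_top
    proof
      fix Z :: real
      obtain L where L: "Z < 2 ^ L" using real_arch_pow[of 2 Z] by auto
      \<comment> \<open>This finite set depends on \<open>w\<close> through \<open>K\<close>, hence
        the quantifier over \<open>F\<close> inside the almost sure statement. As
        \<open>lyap\<close> stays below \<open>K\<close> along the walk, leaving the set forces
        \<open>X n w * 2 ^ L\<close> to be no integer.\<close>
      have "\<forall>\<^sub>F n in sequentially. X n w \<notin> {x \<in> dyadic_rats. x * 2 ^ L \<in> \<int> \<and> lyap x \<le> K}"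
        using elim(1) finite_lyap_sublevel[of L K] by blast
      then show "\<forall>\<^sub>F n in sequentially. Z \<le> norm2 (X n w)"
      proof eventually_elim
        case (elim n)
        then show ?case
          using K[of n] \<open>\<forall>n. X n w \<in> dyadic_rats\<close> norm2_gt[of "X n w" L] L by force
      qed
    qed
  qed
qed

end
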